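(* Let $\alpha,\beta,\gamma,\delta>0$ be the bar lengths of a planar 4-bar linkage of elliptic type satisfying $\alpha^2+\gamma^2=\beta^2+\delta^2$ (the orthodiagonal case). Let $\sigma=\frac{\alpha+\beta+\gamma+\delta}{2}$ and $M=\frac{\alpha\beta\gamma\delta}{(\sigma-\alpha)(\sigma-\beta)(\sigma-\gamma)(\sigma-\delta)}$. Then: (1) $M<1$, and $k:=\sqrt{1-M}=\dfrac{|\alpha\gamma-\beta\delta|}{\alpha\gamma+\beta\delta}$. (2) With $k'=\sqrt{1-k^2}$ and $K'=K(k')$: if $\alpha\gamma>\beta\delta$, then $\mathrm{dc}\left(\frac{K'}{2};k'\right)=\sqrt{\dfrac{\alpha\gamma}{(\sigma-\alpha)(\sigma-\gamma)}}$; and if $\alpha\gamma<\beta\delta$, then $\mathrm{dc}\left(\frac{K'}{2};k'\right)=\sqrt{\dfrac{\beta\delta}{(\sigma-\beta)(\sigma-\delta)}}$.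
   Context: Bar lengths of a planar 4-bar linkage are positive reals each of which is strictly smaller than the sum of the other three. The linkage is of elliptic type if $\alpha-\beta+\gamma-\delta\neq0$, $\alpha-\beta-\gamma+\delta\neq0$ and $\alpha+\beta-\gamma-\delta\neq0$. For modulus $k\in(0,1)$, $K(k)=\int_0^{\pi/2}\frac{d\psi}{\sqrt{1-k^2\sin^2\psi}}$ is the quarter period, and $\mathrm{sn}(\cdot;k),\mathrm{cn}(\cdot;k),\mathrm{dn}(\cdot;k)$ are the Jacobian elliptic functions with modulus $k$: for $X=\int_0^{Y}\frac{d\psi}{\sqrt{1-k^2\sin^2\psi}}$ one has $\mathrm{sn}(X;k)=\sin Y$, $\mathrm{cn}(X;k)=\cos Y$, $\mathrm{dn}(X;k)=\sqrt{1-k^2\sin^2Y}$. Further $\mathrm{dc}(X;k)=\mathrm{dn}(X;k)/\mathrm{cn}(X;k)$. *)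

theory Defs
  imports "HOL-Analysis.Analysis"
begin

definition bar_lengths :: "real \<Rightarrow> real \<Rightarrow> real \<Rightarrow> real \<Rightarrow> bool" where
  "bar_lengths a b c d \<longleftrightarrow>
     0 < a \<and> 0 < b \<and> 0 < c \<and> 0 < d \<and>
     a < b + c + d \<and> b < a + c + d \<and> c < a + b + d \<and> d < a + b + c"

definition elliptic_type :: "real \<Rightarrow> real \<Rightarrow> real \<Rightarrow> real \<Rightarrow> bool" where
  "elliptic_type a b c d \<longleftrightarrow>
     a - b + c - d \<noteq> 0 \<and> a - b - c + d \<noteq> 0 \<and> a + b - c - d \<noteq> 0"

text \<open>
  The second argument of the functions below is the modulus k (not the parameter
  m = k^2); they are meaningful for 0 < k < 1.  The interval integral is oriented, so
  negative amplitudes are covered.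
\<close>

definition elliptic_F :: "real \<Rightarrow> real \<Rightarrow> real" where
  "elliptic_F Y k = (LBINT \<psi>=0..ereal Y. 1 / sqrt (1 - k\<^sup>2 * (sin \<psi>)\<^sup>2))"

definition quarter_period :: "real \<Rightarrow> real" where
  "quarter_period k = (LBINT \<psi>=0..ereal (pi / 2). 1 / sqrt (1 - k\<^sup>2 * (sin \<psi>)\<^sup>2))"

text \<open>
  For 0 < k < 1 the integrand is continuous and at least 1, so the integral is a strictly
  increasing bijection of the reals as a function of Y; hence the amplitude exists and is
  unique for every real X.
\<close>

definition jacobi_am :: "real \<Rightarrow> real \<Rightarrow> real" where
  "jacobi_am X k = (THE Y. X = elliptic_F Y k)"

definition jacobi_sn :: "real \<Rightarrow> real \<Rightarrow> real" where
  "jacobi_sn X k = sin (jacobi_am X k)"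

definition jacobi_cn :: "real \<Rightarrow> real \<Rightarrow> real" where
  "jacobi_cn X k = cos (jacobi_am X k)"

definition jacobi_dn :: "real \<Rightarrow> real \<Rightarrow> real" where
  "jacobi_dn X k = sqrt (1 - k\<^sup>2 * (sin (jacobi_am X k))\<^sup>2)"

definition jacobi_dc :: "real \<Rightarrow> real \<Rightarrow> real" where
  "jacobi_dc X k = jacobi_dn X k / jacobi_cn X k"

end

theory Submission
  imports Defs
begin

text \<open>
  Orthodiagonality gives (\<sigma> - \<alpha>)(\<sigma> - \<gamma>) = (\<sigma> - \<beta>)(\<sigma> - \<delta>) = (\<alpha>\<gamma> + \<beta>\<delta>)/2, which settles the modulus
  and reduces the rest to dc(K/2; m) = sqrt (1 + k), where k is the modulus complementary to m.
  This holds because the substitution tan \<phi> tan \<theta> = 1/k reverses the integral defining K, so its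
  fixed point, tan \<phi> = 1/sqrt k, is the amplitude of K/2.
\<close>

lemma modulus_sin_less_one:
  fixes m x :: real
  assumes "m\<^sup>2 < 1"
  shows "m\<^sup>2 * (sin x)\<^sup>2 < 1"
proof -
  have "m\<^sup>2 * (sin x)\<^sup>2 \<le> m\<^sup>2 * 1"
    by (intro mult_left_mono) (auto simp: abs_square_le_1)
  then show ?thesis using assms by simp
qed

text \<open>The integrand is continuous on the whole line, so it has a global antiderivative
  \<open>G\<close>, and the oriented integral is \<open>G Y - G 0\<close> for either sign of
  \<open>Y\<close>. Hence the derivative is two-sided everywhere, including at 0.\<close>

lemma has_real_derivative_elliptic_F:
  assumes "m\<^sup>2 < 1"
  shows "((\<lambda>Y. elliptic_F Y m) has_real_derivative 1 / sqrt (1 - m\<^sup>2 * (sin x)\<^sup>2)) (at x)"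
proof -
  define f where "f = (\<lambda>x. 1 / sqrt (1 - m\<^sup>2 * (sin x)\<^sup>2))"
  have pos: "1 - m\<^sup>2 * (sin x)\<^sup>2 > 0" for x
    using modulus_sin_less_one[OF assms, of x] by simp
  have cont: "isCont f x" for x
    unfolding f_def using pos[of x] by (intro continuous_intros) auto
  obtain G where G: "\<And>x. (G has_vector_derivative f x) (at x)"
    using einterval_antiderivative[of "-\<infinity>" "\<infinity>" f] cont by auto
  have "elliptic_F Y m = G Y - G 0" for Y
    unfolding elliptic_F_def f_def[symmetric] zero_ereal_def
    by (rule interval_integral_FTC_finite)
       (auto intro: continuous_at_imp_continuous_on cont has_vector_derivative_at_within G)
  moreover have "((\<lambda>Y. G Y - G 0) has_real_derivative f x) (at x)"
    using G[of x] by (auto intro!: derivative_eq_intros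
        simp: has_real_derivative_iff_has_vector_derivative)
  ultimately show ?thesis
    by (simp add: f_def)
qed

lemma strict_mono_elliptic_F:
  assumes "m\<^sup>2 < 1"
  shows "strict_mono (\<lambda>Y. elliptic_F Y m)"
proof (rule strict_monoI)
  fix x y :: real
  assume "x < y"
  then show "elliptic_F x m < elliptic_F y m"
  proof (rule DERIV_pos_imp_increasing)
    fix z
    show "\<exists>D. ((\<lambda>Y. elliptic_F Y m) has_real_derivative D) (at z) \<and> D > 0"
      using has_real_derivative_elliptic_F[OF assms, of z] modulus_sin_less_one[OF assms, of z]
      by (intro exI conjI) auto
  qed
qed

text \<open>\<open>Y\<close> itself witnesses existence for the definite description, and strict
  monotonicity gives uniqueness.\<close>

lemma jacobi_am_elliptic_F:
  assumes "m\<^sup>2 < 1"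
  shows "jacobi_am (elliptic_F Y m) m = Y"
  unfolding jacobi_am_def
  using strict_mono_eq[OF strict_mono_elliptic_F[OF assms]] by (intro the_equality) auto

text \<open>The left side has derivative zero in \<phi>. The second amplitude is the \<theta> with
  tan \<phi> tan \<theta> = 1/k, written with \<open>arctan\<close> so that \<phi> = 0 is covered
  and gives pi/2.\<close>

lemma elliptic_F_reflection:
  fixes k m \<phi> :: real
  assumes k: "0 < k" and km: "k\<^sup>2 + m\<^sup>2 = 1" and \<phi>: "0 \<le> \<phi>" "\<phi> < pi / 2"
  shows "elliptic_F \<phi> m + elliptic_F (pi / 2 - arctan (k * tan \<phi>)) m = quarter_period m"
proof -
  define g where
    "g = (\<lambda>x. elliptic_F x m + elliptic_F (pi / 2 - arctan (k * tan x)) m)"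
  have m: "m\<^sup>2 < 1" and m_eq: "m\<^sup>2 = 1 - k\<^sup>2"
    using k km by (auto simp: algebra_simps) (smt (verit) zero_less_power)
  \<comment> \<open>The interval is open around 0, which yields continuity of \<open>g\<close> at
    the left endpoint 0 later.\<close>
  have deriv: "(g has_real_derivative 0) (at x)" if x: "- (pi / 2) < x" "x < pi / 2" for x
  proof -
    define D where "D = 1 - m\<^sup>2 * (sin x)\<^sup>2"
    define \<theta> where "\<theta> = pi / 2 - arctan (k * tan x)"
    have D: "D > 0" unfolding D_def using modulus_sin_less_one[OF m, of x] by simp
    have c: "cos x > 0" using x by (intro cos_gt_zero_pi) auto
    have D_eq: "D = (cos x)\<^sup>2 + k\<^sup>2 * (sin x)\<^sup>2"
      unfolding D_def m_eq cos_squared_eq by (simp add: algebra_simps)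
    have 1: "1 + (k * tan x)\<^sup>2 = D / (cos x)\<^sup>2"
      using c by (simp add: D_eq tan_def field_simps power2_eq_square)
    have "(sin \<theta>)\<^sup>2 = (cos x)\<^sup>2 / D"
      unfolding \<theta>_def sin_diff using D c by (simp add: cos_arctan 1 power_divide)
    then have "1 - m\<^sup>2 * (sin \<theta>)\<^sup>2 = (D - m\<^sup>2 * (cos x)\<^sup>2) / D"
      using D by (simp add: field_simps)
    \<comment> \<open>The sine and cosine terms add up to 1 - m^2. So the integrand at \<theta> is,
      up to the factor k, the reciprocal of the integrand at x.\<close>
    also have "D - m\<^sup>2 * (cos x)\<^sup>2 = k\<^sup>2"
      unfolding D_def m_eq cos_squared_eq by (simp add: algebra_simps)
    finally have integrand: "1 / sqrt (1 - m\<^sup>2 * (sin \<theta>)\<^sup>2) = sqrt D / k"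
      using k by (simp add: real_sqrt_divide)
    have \<theta>': "((\<lambda>x. pi / 2 - arctan (k * tan x)) has_real_derivative - (k / D)) (at x)"
    proof -
      have "((\<lambda>x. pi / 2 - arctan (k * tan x)) has_real_derivative
              - (inverse (1 + (k * tan x)\<^sup>2) * (k * inverse ((cos x)\<^sup>2)))) (at x)"
        using c by (auto intro!: derivative_eq_intros)
      moreover have "inverse (1 + (k * tan x)\<^sup>2) * (k * inverse ((cos x)\<^sup>2)) = k / D"
        unfolding 1 using c D by (simp add: field_simps)
      ultimately show ?thesis by simp
    qed
    have "((\<lambda>x. elliptic_F (pi / 2 - arctan (k * tan x)) m) has_real_derivative
            sqrt D / k * - (k / D)) (at x)"
      using DERIV_chain2[OF has_real_derivative_elliptic_F[OF m] \<theta>']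
      unfolding \<theta>_def[symmetric] integrand .
    \<comment> \<open>This is the negative of the derivative of the first summand of
      \<open>g\<close>.\<close>
    moreover have "sqrt D / k * - (k / D) = - (1 / sqrt D)"
      using k D by (simp add: field_simps)
    ultimately show ?thesis
      unfolding g_def
      using DERIV_add[OF has_real_derivative_elliptic_F[OF m, of x]] by (fastforce simp: D_def)
  qed
  have "g \<phi> = g 0"
  proof (cases "\<phi> = 0")
    case False
    then show ?thesis
      using \<phi> by (intro DERIV_isconst2[of 0 \<phi>])
        (auto intro!: continuous_at_imp_continuous_on DERIV_isCont deriv)
  qed simp
  also have "\<dots> = quarter_period m"
    by (simp add: g_def elliptic_F_def quarter_period_def flip: zero_ereal_def)
  finally show ?thesis by (simp add: g_def)
qed

lemma elliptic_F_half_quarter_period: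
  fixes k m :: real
  assumes k: "0 < k" and km: "k\<^sup>2 + m\<^sup>2 = 1"
  shows "elliptic_F (arctan (1 / sqrt k)) m = quarter_period m / 2"
proof -
  define Y where "Y = arctan (1 / sqrt k)"
  have "0 \<le> Y"
    using k by (simp add: Y_def)
  moreover have "k * tan Y = sqrt k"
    using k by (simp add: Y_def tan_arctan real_div_sqrt)
  \<comment> \<open>Arctangents of positive reciprocals are complementary, so the two summands of
    the reflection formula coincide at \<open>Y\<close>.\<close>
  moreover have "Y = pi / 2 - arctan (sqrt k)"
    unfolding Y_def using k arctan_inverse[of "sqrt k"] by (simp add: inverse_eq_divide)
  ultimately show ?thesis
    using elliptic_F_reflection[OF assms, of Y] k arctan_ubound[of "1 / sqrt k"]
    unfolding Y_def[symmetric] by simp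
qed

text \<open>At the amplitude with tangent 1/sqrt k, the square of cn is k/(1 + k) and the square of
  dn is k.\<close>

lemma jacobi_dc_half_quarter_period:
  fixes k m :: real
  assumes k: "0 < k" and km: "k\<^sup>2 + m\<^sup>2 = 1"
  shows "jacobi_dc (quarter_period m / 2) m = sqrt (1 + k)"
proof -
  define Y where "Y = arctan (1 / sqrt k)"
  have m: "m\<^sup>2 < 1" and m_eq: "m\<^sup>2 = (1 - k) * (1 + k)"
    using k km by (auto simp: algebra_simps power2_eq_square) (smt (verit) mult_pos_pos)
  have am: "jacobi_am (quarter_period m / 2) m = Y"
    using jacobi_am_elliptic_F[OF m] elliptic_F_half_quarter_period[OF assms] by (metis Y_def)
  have cos: "cos Y = sqrt (k / (1 + k))"
  proof -
    have "1 + (1 / sqrt k)\<^sup>2 = (1 + k) / k"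
      using k by (simp add: power_divide field_simps)
    then show ?thesis
      by (simp add: Y_def cos_arctan real_sqrt_divide)
  qed
  have sin: "(sin Y)\<^sup>2 = 1 / (1 + k)"
    unfolding sin_squared_eq cos using k by (simp add: field_simps)
  have "1 - m\<^sup>2 * (sin Y)\<^sup>2 = k"
    unfolding m_eq sin using k by (simp add: field_simps)
  then show ?thesis
    using k by (simp add: jacobi_dc_def jacobi_dn_def jacobi_cn_def am cos real_sqrt_divide)
qed

theorem mainTheorem7:
  fixes \<alpha> \<beta> \<gamma> \<delta> :: real
  assumes "bar_lengths \<alpha> \<beta> \<gamma> \<delta>"
    and "elliptic_type \<alpha> \<beta> \<gamma> \<delta>"
    and "\<alpha>\<^sup>2 + \<gamma>\<^sup>2 = \<beta>\<^sup>2 + \<delta>\<^sup>2"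
  shows "let \<sigma> = (\<alpha> + \<beta> + \<gamma> + \<delta>) / 2;
             M = \<alpha> * \<beta> * \<gamma> * \<delta> / ((\<sigma> - \<alpha>) * (\<sigma> - \<beta>) * (\<sigma> - \<gamma>) * (\<sigma> - \<delta>));
             k = sqrt (1 - M);
             k' = sqrt (1 - k\<^sup>2);
             K' = quarter_period k'
         in M < 1
          \<and> k = \<bar>\<alpha> * \<gamma> - \<beta> * \<delta>\<bar> / (\<alpha> * \<gamma> + \<beta> * \<delta>)
          \<and> (\<alpha> * \<gamma> > \<beta> * \<delta> \<longrightarrow>
               jacobi_dc (K' / 2) k' = sqrt (\<alpha> * \<gamma> / ((\<sigma> - \<alpha>) * (\<sigma> - \<gamma>))))
          \<and> (\<alpha> * \<gamma> < \<beta> * \<delta> \<longrightarrow>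
               jacobi_dc (K' / 2) k' = sqrt (\<beta> * \<delta> / ((\<sigma> - \<beta>) * (\<sigma> - \<delta>))))"
proof -
  define \<sigma> where "\<sigma> = (\<alpha> + \<beta> + \<gamma> + \<delta>) / 2"
  define S where "S = \<alpha> * \<gamma> + \<beta> * \<delta>"
  define M where "M = \<alpha> * \<beta> * \<gamma> * \<delta> / ((\<sigma> - \<alpha>) * (\<sigma> - \<beta>) * (\<sigma> - \<gamma>) * (\<sigma> - \<delta>))"
  define k where "k = sqrt (1 - M)"
  have pos: "0 < \<alpha>" "0 < \<beta>" "0 < \<gamma>" "0 < \<delta>"
    using assms(1) by (auto simp: bar_lengths_def)
  then have prods: "0 < \<alpha> * \<gamma>" "0 < \<beta> * \<delta>" and S: "0 < S"
    by (auto simp: S_def add_pos_pos)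
  \<comment> \<open>The first product is ((\<beta> + \<delta>)^2 - (\<alpha> - \<gamma>)^2)/4;
    orthodiagonality cancels the pure squares and leaves the mixed terms. The second is
    symmetric.\<close>
  have S1: "(\<sigma> - \<alpha>) * (\<sigma> - \<gamma>) = S / 2" and S2: "(\<sigma> - \<beta>) * (\<sigma> - \<delta>) = S / 2"
    using assms(3) by (auto simp: \<sigma>_def S_def field_simps power2_eq_square)
  \<comment> \<open>Equality would make the differences \<alpha> - \<gamma> and \<beta> - \<delta>
    agree up to sign, and each sign is excluded by the elliptic type. This is what makes
    \<open>k\<close> positive.\<close>
  have ne: "\<alpha> * \<gamma> \<noteq> \<beta> * \<delta>"
  proof
    assume "\<alpha> * \<gamma> = \<beta> * \<delta>"
    then have "(\<alpha> - \<gamma>)\<^sup>2 = (\<beta> - \<delta>)\<^sup>2"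
      using assms(3) by (simp add: power2_diff)
    then have "\<alpha> - \<gamma> = \<beta> - \<delta> \<or> \<alpha> - \<gamma> = - (\<beta> - \<delta>)"
      by (simp only: power2_eq_iff)
    then show False
      using assms(2) by (auto simp: elliptic_type_def)
  qed
  have "(\<sigma> - \<alpha>) * (\<sigma> - \<beta>) * (\<sigma> - \<gamma>) * (\<sigma> - \<delta>)
      = ((\<sigma> - \<alpha>) * (\<sigma> - \<gamma>)) * ((\<sigma> - \<beta>) * (\<sigma> - \<delta>))"
    by (simp add: mult_ac)
  also have "\<dots> = S\<^sup>2 / 4"
    unfolding S1 S2 by (simp add: power2_eq_square)
  finally have prod: "(\<sigma> - \<alpha>) * (\<sigma> - \<beta>) * (\<sigma> - \<gamma>) * (\<sigma> - \<delta>) = S\<^sup>2 / 4" .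
  have M: "M = 4 * (\<alpha> * \<gamma>) * (\<beta> * \<delta>) / S\<^sup>2"
    unfolding M_def prod by (simp add: mult_ac)
  then have M_pos: "0 < M"
    using prods S by simp
  have "S\<^sup>2 - 4 * (\<alpha> * \<gamma>) * (\<beta> * \<delta>) = (\<alpha> * \<gamma> - \<beta> * \<delta>)\<^sup>2"
    by (simp add: S_def power2_eq_square algebra_simps)
  then have M1: "1 - M = ((\<alpha> * \<gamma> - \<beta> * \<delta>) / S)\<^sup>2"
    using S by (simp add: M power_divide eq_divide_eq left_diff_distrib)
  then have k_eq: "k = \<bar>\<alpha> * \<gamma> - \<beta> * \<delta>\<bar> / S"
    using S by (simp add: k_def)
  then have k: "0 < k"
    using ne S by simp
  have "0 < 1 - M"
    using M1 ne S by simp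
  then have M_lt: "M < 1" and k_sq: "1 - k\<^sup>2 = M"
    by (simp_all add: k_def)
  \<comment> \<open>The modulus here is the square root of \<open>M\<close>; positivity of
    \<open>M\<close> ensures that its square is 1 - k^2.\<close>
  have dc: "jacobi_dc (quarter_period (sqrt (1 - k\<^sup>2)) / 2) (sqrt (1 - k\<^sup>2)) = sqrt (1 + k)"
    by (rule jacobi_dc_half_quarter_period[OF k]) (use k_sq M_pos in simp)
  \<comment> \<open>Adding the absolute difference of the two products to their sum \<open>S\<close>
    gives twice the larger one, hence the two cases.\<close>
  have "1 + k = \<alpha> * \<gamma> / (S / 2)" if "\<alpha> * \<gamma> > \<beta> * \<delta>"
    using that S by (simp add: k_eq field_simps) (simp add: S_def)
  moreover have "1 + k = \<beta> * \<delta> / (S / 2)" if "\<alpha> * \<gamma> < \<beta> * \<delta>"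
    using that S by (simp add: k_eq field_simps) (simp add: S_def)
  ultimately show ?thesis
    unfolding Let_def \<sigma>_def[symmetric] M_def[symmetric] k_def[symmetric]
    unfolding S1 S2 dc S_def[symmetric]
    using M_lt k_eq by auto
qed

end
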